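(* Assume that $f$ is $L$-smooth and that, with $\mathcal{L}=\{x\mid F(x)\le F(x^0)\}$, all monotonically nonincreasing sequences in $F(\mathcal{L})$ are bounded from below. Let $\{x^k\}$ be generated by the Riemannian generalized conditional gradient method with the Armijo step size, and suppose that the sequence is infinite, i.e. $\theta(x^k)<0$ for all $k$. Then there exists a finite integer $J\in\mathbb{N}$ such that the method achieves an $\epsilon$-optimal solution within $J+\mathcal{O}(1/\epsilon^2)$ iterations; that is, there are $J\in\mathbb{N}$ and a constant $C>0$, both independent of $\epsilon$, such that for every $\epsilon>0$ some iterate $x^k$ with $k\le J+C/\epsilon^2$ satisfies $|\theta(x^k)|\le\epsilon$.
   Context: Setting. $\mathcal{M}$ is a Riemannian manifold with metric $\langle\cdot,\cdot\rangle_x$ and norm $\|\cdot\|_x$ on $T_x\mathcal{M}$. $R:T\mathcal{M}\to\mathcal{M}$ is a retraction, i.e. a smooth map whose restrictions $R_x:T_x\mathcal{M}\to\mathcal{M}$ satisfy $R_x(0_x)=x$ and $\mathrm{D}R_x(0_x)=\operatorname{id}_{T_x\mathcal{M}}$. A set $\mathcal{S}\subseteq\mathcal{M}$ is $R$-convex if for all $x,y\in\mathcal{S}$ for which $R_x^{-1}(y)$ is well-defined, $R_x(tR_x^{-1}(y))\in\mathcal{S}$ for all $t\in[0,1]$. A function $h:\mathcal{M}\to\mathbb{R}$ is $R$-convex if for all $x,y$ for which $R_x^{-1}(y)$ is well-defined and all $\lambda\in[0,1]$, $h(R_x(\lambda R_x^{-1}(y)))\le(1-\lambda)h(x)+\lambda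 h(y)$. A differentiable function $h:\mathcal{M}\to\mathbb{R}$ is $L$-smooth if there is a constant $L>0$ with $h(y)\le h(x)+\langle\operatorname{grad}h(x),R_x^{-1}(y)\rangle_x+\frac{L}{2}\|R_x^{-1}(y)\|_x^2$ for all $x,y\in\mathcal{M}$ (for which $R_x^{-1}(y)$ is defined). Standing assumptions: $\mathcal{X}\subseteq\mathcal{M}$ is a compact (complete) $R$-convex set over which the retraction $R$ and its inverse $R^{-1}$ are well-defined and smooth, with $R_x^{-1}(y)$ continuous with respect to both $x$ and $y$; $f:\mathcal{M}\to\mathbb{R}$ is continuously differentiable; $g:\mathcal{M}\to\mathbb{R}$ is closed, $R$-convex and lower semicontinuous (possibly nonsmooth); $F:=f+g$. The problem is $\min_{x\in\mathcal{X}}F(x)$. Riemannian generalized conditional gradient method: start from $x^0\in\mathcal{X}$. At iteration $k=0,1,2,\ldots$, let $p(x^k)\in\arg\min_{u\in\mathcal{X}}\{\langle\operatorname{grad}f(x^k),R^{-1}_{x^k}(u)\rangle_{x^k}+g(u)-g(x^k)\}$, let $\theta(x^k)$ be the optimal value of this minimization problem, put $d(x^k)=R^{-1}_{x^k}(p(x^k))$, choose a step size $\lambda_k$, and set $x^{k+1}=R_{x^k}(\lambda_kd(x^k))$. Armijo step size: fix $\zeta\in(0,1)$ and $0<\omega_1<\omega_2<1$. Start with the trial value $\lambda_{k_0}=1$, $\ell=0$. If $F(R_{x^k}(\lambda_{k_\ell}d(x^k)))\le F(x^k)+\zeta\lambda_{k_\ell}\theta(x^k)$, set $\lambda_k:=\lambda_{k_\ell}$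 and stop; otherwise choose any $\lambda_{k_{\ell+1}}\in[\omega_1\lambda_{k_\ell},\omega_2\lambda_{k_\ell}]$, increase $\ell$ by one and repeat the test. An iterate $x^k$ is $\epsilon$-optimal if $|\theta(x^k)|\le\epsilon$. *)

theory Defs
  imports "HOL-Analysis.Analysis"
begin

section \<open>Smooth maps between Euclidean spaces\<close>

text \<open>\<open>Ck_on k U f\<close> is meant for open \<open>U\<close>. In finite dimension, joint continuity of the
  \<open>k\<close>-th derivative is continuity of all iterated directional derivatives.\<close>

fun Ck_on :: "nat \<Rightarrow> 'a::euclidean_space set \<Rightarrow> ('a \<Rightarrow> 'b::real_normed_vector) \<Rightarrow> bool" where
  "Ck_on 0 U f \<longleftrightarrow> continuous_on U f"
| "Ck_on (Suc k) U f \<longleftrightarrow> (\<forall>x\<in>U. f differentiable (at x)) \<and>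
     (\<forall>v. Ck_on k U (\<lambda>x. frechet_derivative f (at x) v))"

text \<open>Smoothness on an arbitrary set: local existence of smooth extensions. On open sets this is
  ordinary \<open>C\<^sup>\<infinity>\<close> smoothness.\<close>

definition smooth_on :: "'a::euclidean_space set \<Rightarrow> ('a \<Rightarrow> 'b::real_normed_vector) \<Rightarrow> bool" where
  "smooth_on S f \<longleftrightarrow>
     (\<forall>a\<in>S. \<exists>U h. open U \<and> a \<in> U \<and> (\<forall>k. Ck_on k U h) \<and> (\<forall>x\<in>S \<inter> U. h x = f x))"

section \<open>Smooth manifolds\<close>

text \<open>A manifold is a whole type \<open>'m\<close> with an atlas of charts into the model space \<open>'e\<close>. A chart is
  a domain together with a map whose values outside the domain are irrelevant. The atlas need not
  be maximal.\<close>

type_synonym ('m, 'e) chart = "'m set \<times> ('m \<Rightarrow> 'e)"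

abbreviation cdom :: "('m, 'e) chart \<Rightarrow> 'm set" where "cdom \<equiv> fst"
abbreviation cmap :: "('m, 'e) chart \<Rightarrow> 'm \<Rightarrow> 'e" where "cmap \<equiv> snd"

definition cimg :: "('m, 'e) chart \<Rightarrow> 'e set" where
  "cimg c = cmap c ` cdom c"

definition cinv :: "('m, 'e) chart \<Rightarrow> 'e \<Rightarrow> 'm" where
  "cinv c = inv_into (cdom c) (cmap c)"

definition is_chart :: "('m::topological_space, 'e::euclidean_space) chart \<Rightarrow> bool" where
  "is_chart c \<longleftrightarrow> open (cdom c) \<and> open (cimg c) \<and>
     homeomorphism (cdom c) (cimg c) (cmap c) (cinv c)"

definition smooth_atlas ::
    "('m::{t2_space, second_countable_topology}, 'e::euclidean_space) chart set \<Rightarrow> bool" where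
  "smooth_atlas A \<longleftrightarrow> (\<forall>c\<in>A. is_chart c) \<and> (\<Union>c\<in>A. cdom c) = UNIV \<and>
     (\<forall>c\<in>A. \<forall>c'\<in>A. smooth_on (cmap c ` (cdom c \<inter> cdom c')) (cmap c' \<circ> cinv c))"

text \<open>Tangent vectors: each point \<open>x\<close> has a preferred chart \<open>chart_at A x\<close>, and \<open>v :: 'e\<close>, regarded
  as an element of \<open>T\<^sub>x\<M>\<close>, is the tangent vector whose coordinates in that chart are \<open>v\<close>. Hence
  each \<open>T\<^sub>x\<M>\<close> is the vector space \<open>'e\<close>. The preferred chart may jump with \<open>x\<close>, so the smooth
  structure of \<open>T\<M>\<close> is not the product structure: it is given by the bundle charts
  \<open>(x, v) \<mapsto> (cmap c x, tcoord A c x v)\<close> over \<open>cdom c\<close>.\<close>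

definition chart_at :: "('m, 'e) chart set \<Rightarrow> 'm \<Rightarrow> ('m, 'e) chart" where
  "chart_at A x = (SOME c. c \<in> A \<and> x \<in> cdom c)"

text \<open>\<open>tcoord A c x v\<close>: coordinates in the chart \<open>c\<close> of \<open>v \<in> T\<^sub>x\<M>\<close>.
  \<open>tvec A c x w\<close>: the vector in \<open>T\<^sub>x\<M>\<close> with coordinates \<open>w\<close> in the chart \<open>c\<close>.\<close>

definition tcoord ::
    "('m, 'e::euclidean_space) chart set \<Rightarrow> ('m, 'e) chart \<Rightarrow> 'm \<Rightarrow> 'e \<Rightarrow> 'e" where
  "tcoord A c x v =
     frechet_derivative (cmap c \<circ> cinv (chart_at A x)) (at (cmap (chart_at A x) x)) v"

definition tvec ::
    "('m, 'e::euclidean_space) chart set \<Rightarrow> ('m, 'e) chart \<Rightarrow> 'm \<Rightarrow> 'e \<Rightarrow> 'e" where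
  "tvec A c x w = frechet_derivative (cmap (chart_at A x) \<circ> cinv c) (at (cmap c x)) w"

definition mfd_differentiable ::
    "('m, 'e::euclidean_space) chart set \<Rightarrow> ('m \<Rightarrow> real) \<Rightarrow> bool" where
  "mfd_differentiable A h \<longleftrightarrow> (\<forall>c\<in>A. \<forall>z\<in>cimg c. (h \<circ> cinv c) differentiable (at z))"

definition mfd_C1 :: "('m, 'e::euclidean_space) chart set \<Rightarrow> ('m \<Rightarrow> real) \<Rightarrow> bool" where
  "mfd_C1 A h \<longleftrightarrow> (\<forall>c\<in>A. Ck_on 1 (cimg c) (h \<circ> cinv c))"

definition mfd_deriv ::
    "('m, 'e::euclidean_space) chart set \<Rightarrow> ('m \<Rightarrow> real) \<Rightarrow> 'm \<Rightarrow> 'e \<Rightarrow> real" where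
  "mfd_deriv A h x v =
     frechet_derivative (h \<circ> cinv (chart_at A x)) (at (cmap (chart_at A x) x)) v"

section \<open>Riemannian metrics\<close>

definition riemannian_metric ::
    "('m, 'e::euclidean_space) chart set \<Rightarrow> ('m \<Rightarrow> 'e \<Rightarrow> 'e \<Rightarrow> real) \<Rightarrow> bool" where
  "riemannian_metric A \<rho> \<longleftrightarrow>
     (\<forall>x. bilinear (\<rho> x) \<and> (\<forall>v w. \<rho> x v w = \<rho> x w v) \<and> (\<forall>v. v \<noteq> 0 \<longrightarrow> \<rho> x v v > 0)) \<and>
     (\<forall>c\<in>A. \<forall>w w'. smooth_on (cimg c)
        (\<lambda>z. \<rho> (cinv c z) (tvec A c (cinv c z) w) (tvec A c (cinv c z) w')))"

definition riemannian_manifold ::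
    "('m::{t2_space, second_countable_topology}, 'e::euclidean_space) chart set \<Rightarrow>
     ('m \<Rightarrow> 'e \<Rightarrow> 'e \<Rightarrow> real) \<Rightarrow> bool" where
  "riemannian_manifold A \<rho> \<longleftrightarrow> smooth_atlas A \<and> riemannian_metric A \<rho>"

definition rnorm :: "('m \<Rightarrow> 'e \<Rightarrow> 'e \<Rightarrow> real) \<Rightarrow> 'm \<Rightarrow> 'e \<Rightarrow> real" where
  "rnorm \<rho> x v = sqrt (\<rho> x v v)"

definition rgrad ::
    "('m, 'e::euclidean_space) chart set \<Rightarrow> ('m \<Rightarrow> 'e \<Rightarrow> 'e \<Rightarrow> real) \<Rightarrow> ('m \<Rightarrow> real) \<Rightarrow> 'm \<Rightarrow> 'e" where
  "rgrad A \<rho> h x = (THE u. \<forall>v. \<rho> x u v = mfd_deriv A h x v)"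

section \<open>Retractions and their inverses\<close>

text \<open>Smoothness of \<open>R\<close> as a map from \<open>T\<M>\<close> to \<open>\<M>\<close>, expressed in all bundle charts of \<open>T\<M>\<close> and
  charts of \<open>\<M>\<close>; openness of the domains of the coordinate representations is continuity.\<close>

definition smooth_from_TM ::
    "('m, 'e::euclidean_space) chart set \<Rightarrow> ('m \<Rightarrow> 'e \<Rightarrow> 'm) \<Rightarrow> bool" where
  "smooth_from_TM A R \<longleftrightarrow>
     (\<forall>c\<in>A. \<forall>c'\<in>A.
        let Rc = (\<lambda>(z, w). R (cinv c z) (tvec A c (cinv c z) w));
            D = {(z, w). z \<in> cimg c \<and> Rc (z, w) \<in> cdom c'}
        in open D \<and> smooth_on D (cmap c' \<circ> Rc))"

text \<open>Since \<open>T\<^sub>x\<M>\<close> is represented in the preferred chart at \<open>x\<close>, the differential of \<open>R x\<close> at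
  \<open>0\<close> is taken in that same chart.\<close>

definition mfd_retraction ::
    "('m, 'e::euclidean_space) chart set \<Rightarrow> ('m \<Rightarrow> 'e \<Rightarrow> 'm) \<Rightarrow> bool" where
  "mfd_retraction A R \<longleftrightarrow> smooth_from_TM A R \<and>
     (\<forall>x. R x 0 = x \<and> ((\<lambda>v. cmap (chart_at A x) (R x v)) has_derivative id) (at 0))"

text \<open>A retraction is in general only locally invertible, so its inverse is always the inverse of
  \<open>R x\<close> restricted to some open neighbourhood \<open>V x\<close> of \<open>0\<close> in \<open>T\<^sub>x\<M>\<close> on which it is injective;
  the inverse at \<open>y\<close> is well-defined iff \<open>y \<in> R x ` V x\<close>.\<close>

definition inversion_domain ::
    "('m \<Rightarrow> 'e::euclidean_space \<Rightarrow> 'm) \<Rightarrow> ('m \<Rightarrow> 'e set) \<Rightarrow> bool" where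
  "inversion_domain R V \<longleftrightarrow> (\<forall>x. open (V x) \<and> 0 \<in> V x \<and> inj_on (R x) (V x))"

definition Rinv_defined :: "('m \<Rightarrow> 'e \<Rightarrow> 'm) \<Rightarrow> ('m \<Rightarrow> 'e set) \<Rightarrow> 'm \<Rightarrow> 'm \<Rightarrow> bool" where
  "Rinv_defined R V x y \<longleftrightarrow> y \<in> R x ` V x"

definition Rinv :: "('m \<Rightarrow> 'e \<Rightarrow> 'm) \<Rightarrow> ('m \<Rightarrow> 'e set) \<Rightarrow> 'm \<Rightarrow> 'm \<Rightarrow> 'e" where
  "Rinv R V x y = inv_into (V x) (R x) y"

text \<open>Well-definedness, smoothness and joint continuity over \<open>X\<close> of the inverse, as a map
  \<open>(x, y) \<mapsto> (x, Rinv R V x y)\<close> from \<open>X \<times> X\<close> to \<open>T\<M>\<close>; the first component is trivially smooth, so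
  only the fibre coordinate appears.\<close>

definition Rinv_regular_on ::
    "('m, 'e::euclidean_space) chart set \<Rightarrow> ('m \<Rightarrow> 'e \<Rightarrow> 'm) \<Rightarrow> ('m \<Rightarrow> 'e set) \<Rightarrow> 'm set \<Rightarrow> bool" where
  "Rinv_regular_on A R V X \<longleftrightarrow>
     (\<forall>x\<in>X. \<forall>y\<in>X. Rinv_defined R V x y) \<and>
     (\<forall>c\<in>A. \<forall>c'\<in>A.
        let S = (cmap c ` (cdom c \<inter> X)) \<times> (cmap c' ` (cdom c' \<inter> X));
            \<Phi> = (\<lambda>(z, z'). tcoord A c (cinv c z) (Rinv R V (cinv c z) (cinv c' z')))
        in smooth_on S \<Phi> \<and> continuous_on S \<Phi>)"

section \<open>Convexity and smoothness relative to a retraction\<close>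

definition R_convex_set ::
    "('m \<Rightarrow> 'e::real_vector \<Rightarrow> 'm) \<Rightarrow> ('m \<Rightarrow> 'e set) \<Rightarrow> 'm set \<Rightarrow> bool" where
  "R_convex_set R V S \<longleftrightarrow>
     (\<forall>x\<in>S. \<forall>y\<in>S. Rinv_defined R V x y \<longrightarrow> (\<forall>t\<in>{0..1}. R x (t *\<^sub>R Rinv R V x y) \<in> S))"

definition R_convex_fun ::
    "('m \<Rightarrow> 'e::real_vector \<Rightarrow> 'm) \<Rightarrow> ('m \<Rightarrow> 'e set) \<Rightarrow> ('m \<Rightarrow> real) \<Rightarrow> bool" where
  "R_convex_fun R V h \<longleftrightarrow>
     (\<forall>x y. Rinv_defined R V x y \<longrightarrow>
        (\<forall>\<mu>\<in>{0..1}. h (R x (\<mu> *\<^sub>R Rinv R V x y)) \<le> (1 - \<mu>) * h x + \<mu> * h y))"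

definition L_smooth ::
    "('m, 'e::euclidean_space) chart set \<Rightarrow> ('m \<Rightarrow> 'e \<Rightarrow> 'e \<Rightarrow> real) \<Rightarrow> ('m \<Rightarrow> 'e \<Rightarrow> 'm) \<Rightarrow>
     ('m \<Rightarrow> 'e set) \<Rightarrow> real \<Rightarrow> ('m \<Rightarrow> real) \<Rightarrow> bool" where
  "L_smooth A \<rho> R V L h \<longleftrightarrow> L > 0 \<and> mfd_differentiable A h \<and>
     (\<forall>x y. Rinv_defined R V x y \<longrightarrow>
        h y \<le> h x + \<rho> x (rgrad A \<rho> h x) (Rinv R V x y) + L / 2 * (rnorm \<rho> x (Rinv R V x y))\<^sup>2)"

definition closed_fun :: "('m::topological_space \<Rightarrow> real) \<Rightarrow> bool" where
  "closed_fun h \<longleftrightarrow> closed {(x, t). h x \<le> t}"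

definition lower_semicontinuous :: "('m::topological_space \<Rightarrow> real) \<Rightarrow> bool" where
  "lower_semicontinuous h \<longleftrightarrow> (\<forall>x. \<forall>a<h x. eventually (\<lambda>y. a < h y) (nhds x))"

section \<open>The generalized conditional gradient method\<close>

definition gcg_obj ::
    "('m, 'e::euclidean_space) chart set \<Rightarrow> ('m \<Rightarrow> 'e \<Rightarrow> 'e \<Rightarrow> real) \<Rightarrow> ('m \<Rightarrow> 'e \<Rightarrow> 'm) \<Rightarrow>
     ('m \<Rightarrow> 'e set) \<Rightarrow> ('m \<Rightarrow> real) \<Rightarrow> ('m \<Rightarrow> real) \<Rightarrow> 'm \<Rightarrow> 'm \<Rightarrow> real" where
  "gcg_obj A \<rho> R V f g x u = \<rho> x (rgrad A \<rho> f x) (Rinv R V x u) + g u - g x"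

definition gcg_theta ::
    "('m, 'e::euclidean_space) chart set \<Rightarrow> ('m \<Rightarrow> 'e \<Rightarrow> 'e \<Rightarrow> real) \<Rightarrow> ('m \<Rightarrow> 'e \<Rightarrow> 'm) \<Rightarrow>
     ('m \<Rightarrow> 'e set) \<Rightarrow> 'm set \<Rightarrow> ('m \<Rightarrow> real) \<Rightarrow> ('m \<Rightarrow> real) \<Rightarrow> 'm \<Rightarrow> real" where
  "gcg_theta A \<rho> R V X f g x = (INF u\<in>X. gcg_obj A \<rho> R V f g x u)"

text \<open>\<open>s\<close> is a possible outcome of the backtracking: trial values \<open>\<tau> 0 = 1, \<dots>, \<tau> l = s\<close>, of which
  exactly the last passes the sufficient decrease test.\<close>

definition armijo_step ::
    "('m \<Rightarrow> 'e::real_vector \<Rightarrow> 'm) \<Rightarrow> ('m \<Rightarrow> real) \<Rightarrow> real \<Rightarrow> real \<Rightarrow> real \<Rightarrow> 'm \<Rightarrow> 'e \<Rightarrow> real \<Rightarrow> real \<Rightarrow> bool" where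
  "armijo_step R F \<zeta> \<omega>1 \<omega>2 x d \<theta> s \<longleftrightarrow>
     (let accept = (\<lambda>t. F (R x (t *\<^sub>R d)) \<le> F x + \<zeta> * t * \<theta>)
      in \<exists>\<tau> l. \<tau> 0 = 1 \<and>
           (\<forall>j<l. \<not> accept (\<tau> j) \<and> \<tau> (Suc j) \<in> {\<omega>1 * \<tau> j .. \<omega>2 * \<tau> j}) \<and>
           accept (\<tau> l) \<and> s = \<tau> l)"

text \<open>An infinite run from \<open>x 0\<close>, with subproblem solutions \<open>p\<close>, directions \<open>d\<close> and step sizes \<open>lam\<close>.\<close>

definition gcg_armijo_run ::
    "('m, 'e::euclidean_space) chart set \<Rightarrow> ('m \<Rightarrow> 'e \<Rightarrow> 'e \<Rightarrow> real) \<Rightarrow> ('m \<Rightarrow> 'e \<Rightarrow> 'm) \<Rightarrow>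
     ('m \<Rightarrow> 'e set) \<Rightarrow> 'm set \<Rightarrow> ('m \<Rightarrow> real) \<Rightarrow> ('m \<Rightarrow> real) \<Rightarrow> real \<Rightarrow> real \<Rightarrow> real \<Rightarrow>
     (nat \<Rightarrow> 'm) \<Rightarrow> (nat \<Rightarrow> 'm) \<Rightarrow> (nat \<Rightarrow> 'e) \<Rightarrow> (nat \<Rightarrow> real) \<Rightarrow> bool" where
  "gcg_armijo_run A \<rho> R V X f g \<zeta> \<omega>1 \<omega>2 x p d lam \<longleftrightarrow>
     x 0 \<in> X \<and>
     (\<forall>k. is_arg_min (gcg_obj A \<rho> R V f g (x k)) (\<lambda>u. u \<in> X) (p k) \<and>
          d k = Rinv R V (x k) (p k) \<and>
          armijo_step R (\<lambda>y. f y + g y) \<zeta> \<omega>1 \<omega>2 (x k) (d k) (gcg_theta A \<rho> R V X f g (x k)) (lam k) \<and>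
          x (Suc k) = R (x k) (lam k *\<^sub>R d k))"

end

(* Along a search direction d = Rinv R V x p, L-smoothness of f and R-convexity of g give
   F (R x (t d)) <= F x + t theta + L t^2 |d|^2 / 2, and |d|^2 is bounded by some B because X is
   compact. Hence every trial step t <= 2 (1 - zeta) |theta| / (L B) is accepted, so each iteration
   decreases F by at least zeta |theta| min 1 (b |theta|) for a constant b > 0. As F is bounded
   below along the iterates, |theta| <= eps occurs within O(1/eps^2) iterations once b eps <= 1;
   larger eps are covered by an iterate J with |theta| <= 1/b. *)
theory Submission
  imports Defs
begin

section \<open>Smooth maps and charts\<close>

lemma smooth_on_imp_continuous_on:
  assumes "smooth_on S f"
  shows "continuous_on S f"
  unfolding continuous_on_eq_continuous_within
proof
  fix a assume a: "a \<in> S"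
  obtain U h where U: "open U" "a \<in> U" and h: "\<forall>k. Ck_on k U h" and eq: "\<forall>x\<in>S \<inter> U. h x = f x"
    using assms a unfolding smooth_on_def by meson
  have "continuous_on U h" using h[rule_format, of 0] by simp
  then have "continuous_on (S \<inter> U) h" by (rule continuous_on_subset) simp
  then have "continuous_on (S \<inter> U) f" by (rule continuous_on_eq) (use eq in blast)
  then have "continuous (at a within S \<inter> U) f"
    using a U by (simp add: continuous_on_eq_continuous_within)
  moreover have "at a within S \<inter> U = at a within S"
    by (rule at_within_nhd[of _ U]) (use U in auto)
  ultimately show "continuous (at a within S) f" by simp
qed

lemma smooth_on_open_imp_differentiable:
  assumes "smooth_on S f" "open S" "a \<in> S"
  shows "f differentiable (at a)"
proof -
  obtain U h where U: "open U" "a \<in> U" and h: "\<forall>k. Ck_on k U h" and eq: "\<forall>x\<in>S \<inter> U. h x = f x"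
    using assms unfolding smooth_on_def by meson
  have "h differentiable (at a)" using h[rule_format, of "Suc 0"] U by simp
  then obtain D where "(h has_derivative D) (at a)" by (auto simp: differentiable_def)
  then have "(f has_derivative D) (at a)"
    by (rule has_derivative_transform_within_open[where s = "S \<inter> U"]) (use assms U eq in auto)
  then show ?thesis by (auto simp: differentiable_def)
qed

lemma is_chart_simps:
  assumes "is_chart c"
  shows "x \<in> cdom c \<Longrightarrow> cinv c (cmap c x) = x"
    and "z \<in> cimg c \<Longrightarrow> cmap c (cinv c z) = z"
    and "z \<in> cimg c \<Longrightarrow> cinv c z \<in> cdom c"
    and "x \<in> cdom c \<Longrightarrow> cmap c x \<in> cimg c"
  using assms unfolding is_chart_def homeomorphism_def by auto

lemma is_chart_continuous:
  assumes "is_chart c"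
  shows "continuous_on (cdom c) (cmap c)" "continuous_on (cimg c) (cinv c)"
  using assms unfolding is_chart_def homeomorphism_def by auto

text \<open>The image is the preimage of \<open>U\<close> under the continuous inverse chart. With
  it, smoothness of transition maps on overlaps becomes differentiability at points.\<close>

lemma open_overlap_image:
  assumes c: "is_chart c" and U: "open U"
  shows "open (cmap c ` (cdom c \<inter> U))"
proof -
  have "cmap c ` (cdom c \<inter> U) = cimg c \<inter> cinv c -` U"
  proof (intro subset_antisym subsetI)
    fix z assume "z \<in> cimg c \<inter> cinv c -` U"
    then have "z = cmap c (cinv c z)" "cinv c z \<in> cdom c \<inter> U"
      by (auto simp: is_chart_simps[OF c])
    then show "z \<in> cmap c ` (cdom c \<inter> U)" by (rule image_eqI)
  qed (auto simp: is_chart_simps[OF c])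
  moreover have "open (cimg c \<inter> cinv c -` U)"
    by (rule continuous_open_preimage[OF is_chart_continuous(2)[OF c] _ U])
      (use c in \<open>simp add: is_chart_def\<close>)
  ultimately show ?thesis by simp
qed

lemma chart_at:
  assumes "smooth_atlas A"
  shows "chart_at A x \<in> A" "x \<in> cdom (chart_at A x)"
proof -
  have "x \<in> (\<Union>c\<in>A. cdom c)" using assms by (simp add: smooth_atlas_def)
  then have "\<exists>c. c \<in> A \<and> x \<in> cdom c" by blast
  from someI_ex[OF this] show "chart_at A x \<in> A" "x \<in> cdom (chart_at A x)"
    by (auto simp: chart_at_def)
qed

section \<open>Changes of tangent coordinates\<close>

text \<open>\<open>frechet_derivative\<close> is a choice operator, so \<open>tcoord\<close> and
  \<open>tvec\<close> carry information only once transition maps are known to be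
  differentiable.\<close>

lemma transition_has_derivative:
  assumes A: "smooth_atlas A" and c: "c \<in> A" "c' \<in> A" and x: "x \<in> cdom c" "x \<in> cdom c'"
  shows "((cmap c' \<circ> cinv c) has_derivative
    frechet_derivative (cmap c' \<circ> cinv c) (at (cmap c x))) (at (cmap c x))"
proof -
  have "is_chart c" "open (cdom c')"
    using A c by (auto simp: smooth_atlas_def is_chart_def)
  then have "open (cmap c ` (cdom c \<inter> cdom c'))" by (rule open_overlap_image)
  then have "(cmap c' \<circ> cinv c) differentiable (at (cmap c x))"
    by (rule smooth_on_open_imp_differentiable[rotated]) (use A c x in \<open>auto simp: smooth_atlas_def\<close>)
  then show ?thesis by (simp add: frechet_derivative_works)
qed

text \<open>Chain rule for a composite that is the identity near the point, followed by uniqueness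
  of the derivative.\<close>

lemma transition_derivative_inverse:
  assumes A: "smooth_atlas A" and c: "c \<in> A" "c' \<in> A" and x: "x \<in> cdom c" "x \<in> cdom c'"
  shows "frechet_derivative (cmap c \<circ> cinv c') (at (cmap c' x))
    (frechet_derivative (cmap c' \<circ> cinv c) (at (cmap c x)) v) = v"
proof -
  have ch: "is_chart c" "is_chart c'" "open (cdom c')"
    using A c by (auto simp: smooth_atlas_def is_chart_def)
  let ?D = "frechet_derivative (cmap c' \<circ> cinv c) (at (cmap c x))"
  let ?E = "frechet_derivative (cmap c \<circ> cinv c') (at (cmap c' x))"
  have "(cmap c' \<circ> cinv c) (cmap c x) = cmap c' x"
    using x by (simp add: is_chart_simps[OF ch(1)])
  then have "((cmap c \<circ> cinv c') \<circ> (cmap c' \<circ> cinv c) has_derivative ?E \<circ> ?D) (at (cmap c x))"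
    using transition_has_derivative[OF A c x] transition_has_derivative[OF A c(2,1) x(2,1)]
    by (intro diff_chain_at) simp_all
  then have "((\<lambda>z. z) has_derivative ?E \<circ> ?D) (at (cmap c x))"
    by (rule has_derivative_transform_within_open[where s = "cmap c ` (cdom c \<inter> cdom c')"])
      (use x ch in \<open>auto simp: is_chart_simps open_overlap_image\<close>)
  then have "?E \<circ> ?D = (\<lambda>z. z)" by (rule has_derivative_unique) simp
  then show ?thesis by (metis comp_apply)
qed

lemma tvec_tcoord:
  assumes "smooth_atlas A" "c \<in> A" "x \<in> cdom c"
  shows "tvec A c x (tcoord A c x v) = v"
  unfolding tvec_def tcoord_def
  by (rule transition_derivative_inverse) (use assms chart_at in auto)

lemma linear_tvec:
  assumes "smooth_atlas A" "c \<in> A" "x \<in> cdom c"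
  shows "linear (tvec A c x)"
  unfolding tvec_def
  using transition_has_derivative[OF assms(1,2) chart_at(1) assms(3) chart_at(2)] assms
  by (metis has_derivative_linear)

text \<open>Makes fibre coordinates in the preferred chart equal to the vectors themselves, so that
  statements in bundle charts can be read at a fixed base point.\<close>

lemma transition_derivative_self:
  assumes A: "smooth_atlas A" and c: "c \<in> A" and x: "x \<in> cdom c"
  shows "frechet_derivative (cmap c \<circ> cinv c) (at (cmap c x)) v = v"
proof -
  have ch: "is_chart c" using A c by (auto simp: smooth_atlas_def)
  have "((\<lambda>z. z) has_derivative (\<lambda>z. z)) (at (cmap c x))" by simp
  then have "((cmap c \<circ> cinv c) has_derivative (\<lambda>z. z)) (at (cmap c x))"
    by (rule has_derivative_transform_within_open[where s = "cimg c"])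
      (use x ch in \<open>auto simp: is_chart_simps is_chart_def\<close>)
  then show ?thesis by (metis frechet_derivative_at)
qed

lemma tcoord_chart_at: "smooth_atlas A \<Longrightarrow> tcoord A (chart_at A x) x v = v"
  unfolding tcoord_def by (rule transition_derivative_self) (auto simp: chart_at)

lemma tvec_chart_at: "smooth_atlas A \<Longrightarrow> tvec A (chart_at A x) x v = v"
  unfolding tvec_def by (rule transition_derivative_self) (auto simp: chart_at)

section \<open>Retractions along segments\<close>

text \<open>In the bundle chart over \<open>chart_at A x\<close>, the map \<open>R x\<close> is a
  slice of the coordinate representation \<open>Rc\<close>, which is continuous.\<close>

lemma continuous_on_smooth_from_TM:
  assumes A: "smooth_atlas A" and R: "smooth_from_TM A R"
  shows "continuous_on UNIV (R x)"
  unfolding continuous_on_eq_continuous_within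
proof
  fix v
  define c where "c = chart_at A x"
  define c' where "c' = chart_at A (R x v)"
  have c: "c \<in> A" "x \<in> cdom c" and c': "c' \<in> A" "R x v \<in> cdom c'"
    using chart_at[OF A] by (auto simp: c_def c'_def)
  have ch: "is_chart c" "is_chart c'" using A c c' by (auto simp: smooth_atlas_def)
  define Rc where "Rc = (\<lambda>(z, w). R (cinv c z) (tvec A c (cinv c z) w))"
  define D where "D = {(z, w). z \<in> cimg c \<and> Rc (z, w) \<in> cdom c'}"
  define W where "W = {w. R x w \<in> cdom c'}"
  have "open D" "smooth_on D (cmap c' \<circ> Rc)"
    using R c c' unfolding smooth_from_TM_def Let_def D_def Rc_def by blast+
  have Rc: "Rc (cmap c x, w) = R x w" for w
    using c A ch by (simp add: Rc_def is_chart_simps c_def tvec_chart_at)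
  have D: "(cmap c x, w) \<in> D \<longleftrightarrow> w \<in> W" for w
    using c ch by (simp add: D_def Rc W_def is_chart_simps)
  have "W = Pair (cmap c x) -` D" using D by auto
  \<comment> \<open>Openness of \<open>D\<close> keeps \<open>R x w\<close> in the target chart for
    \<open>w\<close> near \<open>v\<close>; continuity in coordinates alone would not.\<close>
  then have "open W" using \<open>open D\<close> by (auto intro!: open_vimage continuous_intros)
  have "continuous_on W ((cmap c' \<circ> Rc) \<circ> Pair (cmap c x))"
    by (rule continuous_on_compose[OF _ continuous_on_subset[OF
          smooth_on_imp_continuous_on[OF \<open>smooth_on D (cmap c' \<circ> Rc)\<close>]]])
      (auto simp: D intro!: continuous_intros)
  then have "continuous_on W (\<lambda>w. cmap c' (R x w))" by (simp add: o_def Rc)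
  then have "continuous_on W (\<lambda>w. cinv c' (cmap c' (R x w)))"
    by (rule continuous_on_compose2[OF is_chart_continuous(2)[OF ch(2)]])
      (auto simp: W_def is_chart_simps ch)
  then have "continuous_on W (R x)"
    by (rule continuous_on_eq)
      (auto simp: W_def is_chart_simps ch)
  then have "isCont (R x) v"
    using \<open>open W\<close> c' by (auto simp: continuous_on_eq_continuous_at W_def)
  then show "continuous (at v within UNIV) (R x)" by simp
qed

text \<open>Stated through \<open>tcoord\<close> because the preferred chart may jump with
  \<open>x\<close>, so the raw values of \<open>Rinv\<close> can jump with it.\<close>

lemma continuous_on_tcoord_Rinv:
  assumes A: "smooth_atlas A" and V: "Rinv_regular_on A R V X" and c: "c \<in> A" "c' \<in> A"
  shows "continuous_on ((cdom c \<inter> X) \<times> (cdom c' \<inter> X))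
    (\<lambda>(x, y). tcoord A c x (Rinv R V x y))"
proof -
  have ch: "is_chart c" "is_chart c'" using A c by (auto simp: smooth_atlas_def)
  have *: "continuous_on ((cmap c ` (cdom c \<inter> X)) \<times> (cmap c' ` (cdom c' \<inter> X)))
      (\<lambda>(z, z'). tcoord A c (cinv c z) (Rinv R V (cinv c z) (cinv c' z')))"
    using V c by (simp add: Rinv_regular_on_def Let_def)
  have "continuous_on (cdom c \<inter> X) (cmap c)" "continuous_on (cdom c' \<inter> X) (cmap c')"
    by (rule continuous_on_subset[OF is_chart_continuous(1)[OF ch(1)]], blast)
      (rule continuous_on_subset[OF is_chart_continuous(1)[OF ch(2)]], blast)
  then have "continuous_on ((cdom c \<inter> X) \<times> (cdom c' \<inter> X)) (\<lambda>q. (cmap c (fst q), cmap c' (snd q)))"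
    by (auto intro!: continuous_intros elim!: continuous_on_compose2)
  then have "continuous_on ((cdom c \<inter> X) \<times> (cdom c' \<inter> X)) (\<lambda>q. (\<lambda>(z, z'). tcoord A c (cinv c z)
      (Rinv R V (cinv c z) (cinv c' z'))) (cmap c (fst q), cmap c' (snd q)))"
    by (rule continuous_on_compose2[OF *]) (auto simp: mem_Times_iff)
  then show ?thesis
    by (rule continuous_on_eq) (auto simp: is_chart_simps ch)
qed

text \<open>With the base point fixed, the preferred chart at \<open>x\<close> removes
  \<open>tcoord\<close>.\<close>

lemma continuous_on_Rinv:
  assumes A: "smooth_atlas A" and V: "Rinv_regular_on A R V X" and x: "x \<in> X"
  shows "continuous_on X (Rinv R V x)"
  unfolding continuous_on_eq_continuous_within
proof
  fix y assume y: "y \<in> X"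
  let ?c = "chart_at A x" and ?c' = "chart_at A y"
  have "continuous_on (cdom ?c' \<inter> X) (\<lambda>u. (\<lambda>(x, y). tcoord A ?c x (Rinv R V x y)) (x, u))"
    by (rule continuous_on_compose2[OF continuous_on_tcoord_Rinv[OF A V chart_at(1)[OF A] chart_at(1)[OF A]]])
      (use x chart_at[OF A] in \<open>auto intro!: continuous_intros\<close>)
  then have "continuous_on (X \<inter> cdom ?c') (Rinv R V x)"
    by (simp add: tcoord_chart_at[OF A] Int_commute)
  then have "continuous (at y within X \<inter> cdom ?c') (Rinv R V x)"
    using y chart_at[OF A] by (simp add: continuous_on_eq_continuous_within)
  moreover have "open (cdom ?c')"
    using A chart_at(1)[OF A] by (auto simp: smooth_atlas_def is_chart_def)
  then have "at y within X \<inter> cdom ?c' = at y within X"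
    using chart_at(2)[OF A] by (intro at_within_nhd[of _ "cdom ?c'"]) auto
  ultimately show "continuous (at y within X) (Rinv R V x)" by simp
qed

lemma Rinv_R: "inversion_domain R V \<Longrightarrow> v \<in> V x \<Longrightarrow> Rinv R V x (R x v) = v"
  by (simp add: inversion_domain_def Rinv_def)

text \<open>The domain \<open>V x\<close> need not be star-shaped. The set of \<open>t\<close> for which the inverse returns
  \<open>t *\<^sub>R v\<close> is closed because the inverse is continuous, and open because \<open>V x\<close> is open.\<close>

lemma Rinv_segment:
  assumes A: "smooth_atlas A" and R: "smooth_from_TM A R" "R x 0 = x" and inj: "inversion_domain R V"
    and conv: "R_convex_set R V X" and V: "Rinv_regular_on A R V X"
    and x: "x \<in> X" and y: "y \<in> X" and t: "t \<in> {0..1}"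
  shows "Rinv R V x (R x (t *\<^sub>R Rinv R V x y)) = t *\<^sub>R Rinv R V x y"
proof -
  define v where "v = Rinv R V x y"
  define \<gamma> where "\<gamma> = (\<lambda>t. Rinv R V x (R x (t *\<^sub>R v)))"
  define T where "T = {t \<in> {0..1}. \<gamma> t = t *\<^sub>R v}"
  have def: "Rinv_defined R V x u" if "u \<in> X" for u
    using V x that by (simp add: Rinv_regular_on_def)
  have seg: "R x (t *\<^sub>R v) \<in> X" if "t \<in> {0..1}" for t
    using conv x y def[OF y] that unfolding R_convex_set_def v_def by blast
  have "continuous_on {0..1} (\<lambda>t. R x (t *\<^sub>R v))"
    by (rule continuous_on_compose2[OF continuous_on_smooth_from_TM[OF A R(1)]])
      (auto intro!: continuous_intros)
  then have cont: "continuous_on {0..1} \<gamma>"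
    unfolding \<gamma>_def by (rule continuous_on_compose2[OF continuous_on_Rinv[OF A V x]]) (use seg in auto)
  then have "closedin (top_of_set {0..1}) {t \<in> {0..1}. \<gamma> t - t *\<^sub>R v = 0}"
    by (intro continuous_closedin_preimage_constant continuous_on_diff cont)
      (intro continuous_intros)
  then have closed: "closedin (top_of_set {0..1}) T" by (simp add: T_def)
  \<comment> \<open>An inverse always takes its values in \<open>V x\<close>, so returning
    \<open>s *\<^sub>R v\<close> forces that vector into \<open>V x\<close>; the converse is
    injectivity.\<close>
  have T_eq: "T = {0..1} \<inter> (\<lambda>t. t *\<^sub>R v) -` V x"
  proof (intro subset_antisym subsetI)
    fix s assume "s \<in> T"
    then have s: "s \<in> {0..1}" "\<gamma> s = s *\<^sub>R v" by (auto simp: T_def)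
    have "\<gamma> s \<in> V x"
      using def[OF seg[OF s(1)]] unfolding \<gamma>_def Rinv_def Rinv_defined_def by (rule inv_into_into)
    then show "s \<in> {0..1} \<inter> (\<lambda>t. t *\<^sub>R v) -` V x" using s by simp
  qed (use inj in \<open>auto simp: T_def \<gamma>_def Rinv_R\<close>)
  have "open ((\<lambda>t::real. t *\<^sub>R v) -` V x)"
    using inj by (intro open_vimage continuous_on_scaleR continuous_on_id continuous_on_const)
      (simp add: inversion_domain_def)
  then have "openin (top_of_set {0..1}) T" unfolding T_eq by (rule openin_open_Int)
  moreover have "0 \<in> T"
  proof -
    have "0 \<in> V x" using inj by (simp add: inversion_domain_def)
    then have "Rinv R V x x = 0" using Rinv_R[OF inj, of 0 x] R(2) by simp
    then show ?thesis by (simp add: T_def \<gamma>_def R(2))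
  qed
  ultimately have "T = {0..1}"
    using closed connected_Icc[of "0::real" 1] unfolding connected_clopen by blast
  then have "t \<in> T" using t by simp
  then show ?thesis by (simp add: T_def \<gamma>_def v_def)
qed

text \<open>Positivity is assumed for nonzero vectors only; the zero vector is settled by
  bilinearity.\<close>

lemma rnorm_power2:
  assumes "riemannian_metric A \<rho>"
  shows "(rnorm \<rho> x v)\<^sup>2 = \<rho> x v v"
proof (cases "v = 0")
  case True
  then have "\<rho> x v v = 0"
    using assms bilinear_lzero[of "\<rho> x"] by (simp add: riemannian_metric_def)
  then show ?thesis by (simp add: rnorm_def)
next
  case False
  then have "\<rho> x v v > 0" using assms by (simp add: riemannian_metric_def)
  then show ?thesis by (simp add: rnorm_def)
qed

section \<open>A uniform bound on the length of search directions\<close>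

text \<open>The squared length does not depend on the chart, so it is continuous on the compact set
  \<open>X \<times> X\<close> even where the raw vectors jump.\<close>

lemma bounded_rnorm_Rinv:
  assumes A: "riemannian_manifold A \<rho>" and X: "compact X" and V: "Rinv_regular_on A R V X"
  obtains B where "B > 0" "\<And>x y. x \<in> X \<Longrightarrow> y \<in> X \<Longrightarrow> (rnorm \<rho> x (Rinv R V x y))\<^sup>2 \<le> B"
proof -
  have at: "smooth_atlas A" and met: "riemannian_metric A \<rho>"
    using A by (auto simp: riemannian_manifold_def)
  define q where "q = (\<lambda>(x, y). \<rho> x (Rinv R V x y) (Rinv R V x y))"
  have "continuous_on (X \<times> X) q"
    unfolding continuous_on_eq_continuous_within
  proof
    fix ab assume "ab \<in> X \<times> X"
    then obtain a b where ab: "ab = (a, b)" "a \<in> X" "b \<in> X" by auto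
    define c where "c = chart_at A a"
    define c' where "c' = chart_at A b"
    have c: "c \<in> A" "a \<in> cdom c" and c': "c' \<in> A" "b \<in> cdom c'"
      using chart_at[OF at] by (auto simp: c_def c'_def)
    have ch: "is_chart c" "is_chart c'" using at c c' by (auto simp: smooth_atlas_def)
    let ?S = "(cdom c \<inter> X) \<times> (cdom c' \<inter> X)"
    let ?w = "\<lambda>q. tcoord A c (fst q) (Rinv R V (fst q) (snd q))"
    let ?g = "\<lambda>i j x. \<rho> x (tvec A c x i) (tvec A c x j)"
    have "continuous_on (cimg c) (\<lambda>z. ?g i j (cinv c z))" for i j
      using met c by (intro smooth_on_imp_continuous_on) (auto simp: riemannian_metric_def)
    then have "continuous_on (cdom c) (\<lambda>x. ?g i j (cinv c (cmap c x)))" for i j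
      by (rule continuous_on_compose2[OF _ is_chart_continuous(1)[OF ch(1)]])
        (auto simp: is_chart_simps ch)
    then have "continuous_on (cdom c) (?g i j)" for i j
      by (rule continuous_on_eq) (auto simp: is_chart_simps ch)
    then have g: "continuous_on ?S (\<lambda>q. ?g i j (fst q))" for i j
      by (rule continuous_on_compose2) (auto intro!: continuous_intros)
    have w: "continuous_on ?S ?w"
      using continuous_on_tcoord_Rinv[OF at V c(1) c'(1)] by (simp add: case_prod_beta')
    \<comment> \<open>The squared length in the chart \<open>c\<close>: the Gram matrix
      \<open>?g i j\<close> of the coordinate basis applied to the coordinates
      \<open>?w\<close>.\<close>
    have "continuous_on ?S
        (\<lambda>q. \<Sum>i\<in>Basis. \<Sum>j\<in>Basis. (?w q \<bullet> i) * ((?w q \<bullet> j) * ?g i j (fst q)))"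
      by (intro continuous_intros w g)
    moreover have "(\<Sum>i\<in>Basis. \<Sum>j\<in>Basis. (?w u \<bullet> i) * ((?w u \<bullet> j) * ?g i j (fst u))) = q u"
      if u_in: "u \<in> ?S" for u
    proof -
      obtain x y where u: "u = (x, y)" "x \<in> cdom c" using u_in by (cases u) auto
      define w where "w = tcoord A c x (Rinv R V x y)"
      have lin: "linear (tvec A c x)" by (rule linear_tvec[OF at c(1) u(2)])
      have bil: "bilinear (\<rho> x)" using met by (simp add: riemannian_metric_def)
      have "tvec A c x w = tvec A c x (\<Sum>i\<in>Basis. (w \<bullet> i) *\<^sub>R i)" by (simp add: euclidean_representation)
      also have "\<dots> = (\<Sum>i\<in>Basis. (w \<bullet> i) *\<^sub>R tvec A c x i)"
        by (simp add: linear_sum[OF lin] linear_scale[OF lin])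
      finally have tw: "tvec A c x w = (\<Sum>i\<in>Basis. (w \<bullet> i) *\<^sub>R tvec A c x i)" .
      have "q u = \<rho> x (tvec A c x w) (tvec A c x w)"
        using tvec_tcoord[OF at c(1) u(2)] by (simp add: q_def u w_def)
      also have "\<dots> = (\<Sum>i\<in>Basis. \<Sum>j\<in>Basis. (w \<bullet> i) * ((w \<bullet> j) * ?g i j x))"
        unfolding tw bilinear_sum[OF bil] sum.cartesian_product[symmetric]
        by (simp add: bilinear_lmul[OF bil] bilinear_rmul[OF bil] mult.left_commute)
      finally show ?thesis by (simp add: u w_def)
    qed
    ultimately have "continuous_on ?S q"
      by (rule continuous_on_eq) auto
    then have "continuous (at ab within ?S) q"
      using ab c c' by (simp add: continuous_on_eq_continuous_within)
    moreover have "at ab within ?S = at ab within X \<times> X"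
      by (rule at_within_nhd[of _ "cdom c \<times> cdom c'"])
        (use ab c c' ch in \<open>auto simp: is_chart_def open_Times\<close>)
    ultimately show "continuous (at ab within X \<times> X) q" by simp
  qed
  then have "bounded (q ` (X \<times> X))"
    using X by (intro compact_imp_bounded compact_continuous_image compact_Times)
  \<comment> \<open>A strictly positive bound, even if all directions vanish, since \<open>B\<close>
    later becomes a divisor.\<close>
  then obtain B where "B > 0" and B: "\<forall>r \<in> q ` (X \<times> X). norm r \<le> B"
    by (auto simp: bounded_pos)
  show ?thesis
  proof
    show "B > 0" by fact
    fix x y assume "x \<in> X" "y \<in> X"
    then have "\<bar>q (x, y)\<bar> \<le> B" using B by auto
    then show "(rnorm \<rho> x (Rinv R V x y))\<^sup>2 \<le> B" by (simp add: q_def rnorm_power2[OF met])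
  qed
qed

section \<open>Step sizes and complexity\<close>

text \<open>Either the first trial 1 is accepted, or the last rejected trial exceeds \<delta> and
  the accepted one is at least \<omega>1 times it.\<close>

lemma armijo_step_bounds:
  assumes step: "armijo_step R F \<zeta> \<omega>1 \<omega>2 x d \<theta> s"
    and \<omega>: "0 < \<omega>1" "\<omega>2 < 1"
    and acc: "\<And>t. 0 < t \<Longrightarrow> t \<le> 1 \<Longrightarrow> t \<le> \<delta> \<Longrightarrow> F (R x (t *\<^sub>R d)) \<le> F x + \<zeta> * t * \<theta>"
  shows "0 < s" "s \<le> 1" "min 1 (\<omega>1 * \<delta>) \<le> s" "F (R x (s *\<^sub>R d)) \<le> F x + \<zeta> * s * \<theta>"
proof -
  obtain \<tau> l where \<tau>: "\<tau> 0 = 1" "s = \<tau> l" and fin: "F (R x (\<tau> l *\<^sub>R d)) \<le> F x + \<zeta> * \<tau> l * \<theta>"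
    and rej: "\<And>j. j < l \<Longrightarrow> \<not> F (R x (\<tau> j *\<^sub>R d)) \<le> F x + \<zeta> * \<tau> j * \<theta>"
    and red: "\<And>j. j < l \<Longrightarrow> \<tau> (Suc j) \<in> {\<omega>1 * \<tau> j .. \<omega>2 * \<tau> j}"
    using step unfolding armijo_step_def Let_def by blast
  \<comment> \<open>All trials stay in the range where \<open>acc\<close> applies, so a rejected
    trial cannot be at most \<delta>.\<close>
  have bnd: "0 < \<tau> j \<and> \<tau> j \<le> 1" if "j \<le> l" for j
    using that
  proof (induction j)
    case (Suc j)
    then have "0 < \<tau> j" "\<tau> j \<le> 1" "\<omega>1 * \<tau> j \<le> \<tau> (Suc j)" "\<tau> (Suc j) \<le> \<omega>2 * \<tau> j"
      using red[of j] by auto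
    moreover have "0 < \<omega>1 * \<tau> j" "\<omega>2 * \<tau> j \<le> 1 * \<tau> j"
      using \<open>0 < \<tau> j\<close> \<omega> by (auto intro!: mult_right_mono)
    ultimately show ?case by linarith
  qed (use \<tau> in simp)
  then show "0 < s" "s \<le> 1" using \<tau> by auto
  show "F (R x (s *\<^sub>R d)) \<le> F x + \<zeta> * s * \<theta>" using fin \<tau> by simp
  show "min 1 (\<omega>1 * \<delta>) \<le> s"
  proof (cases l)
    case (Suc j)
    then have "\<delta> \<le> \<tau> j" using rej[of j] acc[of "\<tau> j"] bnd[of j] by force
    then have "\<omega>1 * \<delta> \<le> \<omega>1 * \<tau> j" using \<omega> by simp
    also have "\<dots> \<le> s" using red[of j] Suc \<tau> by simp
    finally show ?thesis by simp
  qed (use \<tau> in simp)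
qed

text \<open>While \<bar>\<theta> k\<bar> exceeds a small \<epsilon>, each step costs at least
  \<zeta> b \<epsilon> squared, and the total cost cannot exceed \<open>a 0 - m\<close> for a lower
  bound \<open>m\<close>.\<close>

lemma sufficient_decrease_complexity:
  fixes a \<theta> :: "nat \<Rightarrow> real"
  assumes \<zeta>: "0 < \<zeta>" and b: "0 < b"
    and dec: "\<And>k. a (Suc k) \<le> a k - \<zeta> * min 1 (b * \<bar>\<theta> k\<bar>) * \<bar>\<theta> k\<bar>"
    and below: "bdd_below (range a)"
  shows "\<exists>(J::nat) (C::real). C > 0 \<and> (\<forall>\<epsilon>>0. \<exists>k. real k \<le> real J + C / \<epsilon>\<^sup>2 \<and> \<bar>\<theta> k\<bar> \<le> \<epsilon>)"
proof -
  obtain m where m: "\<And>k. m \<le> a k" using below by (auto simp: bdd_below_def)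
  \<comment> \<open>The added 1 keeps \<open>C\<close> positive when \<open>a 0 = m\<close> and
    makes the final contradiction strict.\<close>
  define C where "C = (a 0 - m + 1) / (\<zeta> * b)"
  have C: "C > 0" using m[of 0] \<zeta> b by (simp add: C_def)
  have small: "\<exists>k. real k \<le> C / \<epsilon>\<^sup>2 \<and> \<bar>\<theta> k\<bar> \<le> \<epsilon>" if \<epsilon>: "0 < \<epsilon>" "b * \<epsilon> \<le> 1" for \<epsilon>
  proof (rule ccontr)
    assume "\<not> ?thesis"
    then have large: "\<epsilon> < \<bar>\<theta> k\<bar>" if "real k \<le> C / \<epsilon>\<^sup>2" for k using that by force
    \<comment> \<open>The range reaches one past \<open>C / \<epsilon>\<^sup>2\<close> because the
      decrease into step \<open>Suc n\<close> needs \<theta> to be large only at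
      \<open>n\<close>.\<close>
    have descent: "a n \<le> a 0 - real n * (\<zeta> * b * \<epsilon>\<^sup>2)" if "real n \<le> C / \<epsilon>\<^sup>2 + 1" for n
      using that
    proof (induction n)
      case (Suc n)
      then have n: "\<epsilon> < \<bar>\<theta> n\<bar>" using large by simp
      \<comment> \<open>The cap at 1 is why \<epsilon> is restricted to
        \<open>b * \<epsilon> \<le> 1\<close>.\<close>
      have "b * \<epsilon> \<le> min 1 (b * \<bar>\<theta> n\<bar>)" using n \<epsilon> b by simp
      then have "(b * \<epsilon>) * \<epsilon> \<le> min 1 (b * \<bar>\<theta> n\<bar>) * \<bar>\<theta> n\<bar>"
        using n \<epsilon> b by (intro mult_mono) auto
      then have "\<zeta> * (b * \<epsilon> * \<epsilon>) \<le> \<zeta> * (min 1 (b * \<bar>\<theta> n\<bar>) * \<bar>\<theta> n\<bar>)" using \<zeta> by simp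
      then show ?case using Suc dec[of n] by (simp add: algebra_simps power2_eq_square)
    qed simp
    \<comment> \<open>The first integer above \<open>C / \<epsilon>\<^sup>2\<close>; there the
      descent would push \<open>a n\<close> down to \<open>m - 1\<close>.\<close>
    define n where "n = Suc (nat \<lfloor>C / \<epsilon>\<^sup>2\<rfloor>)"
    have "0 \<le> C / \<epsilon>\<^sup>2" using C by simp
    then have n: "real n \<le> C / \<epsilon>\<^sup>2 + 1" "C / \<epsilon>\<^sup>2 \<le> real n"
      unfolding n_def by linarith+
    have "a 0 - m + 1 = C / \<epsilon>\<^sup>2 * (\<zeta> * b * \<epsilon>\<^sup>2)" using \<epsilon> \<zeta> b by (simp add: C_def)
    also have "\<dots> \<le> real n * (\<zeta> * b * \<epsilon>\<^sup>2)" using n \<zeta> b by (intro mult_right_mono) auto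
    finally show False using descent[OF n(1)] m[of n] by simp
  qed
  obtain J where J: "\<bar>\<theta> J\<bar> \<le> 1 / b" using small[of "1 / b"] b by auto
  have "\<exists>k. real k \<le> real J + C / \<epsilon>\<^sup>2 \<and> \<bar>\<theta> k\<bar> \<le> \<epsilon>" if \<epsilon>: "0 < \<epsilon>" for \<epsilon>
  proof (cases "b * \<epsilon> \<le> 1")
    case True
    with small[OF \<epsilon>] obtain k where "real k \<le> C / \<epsilon>\<^sup>2" "\<bar>\<theta> k\<bar> \<le> \<epsilon>" by blast
    then show ?thesis by (intro exI[of _ k]) auto
  next
    case False
    then have "1 / b \<le> \<epsilon>" using b by (simp add: field_simps)
    then show ?thesis using J C by (intro exI[of _ J]) auto
  qed
  with C show ?thesis by blast
qed

section \<open>Sufficient decrease along the run of the method\<close>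

theorem theorem4p7:
  fixes A :: "('m::{t2_space, second_countable_topology}, 'e::euclidean_space) chart set"
    and \<rho> :: "'m \<Rightarrow> 'e \<Rightarrow> 'e \<Rightarrow> real"
    and R :: "'m \<Rightarrow> 'e \<Rightarrow> 'm"
    and V :: "'m \<Rightarrow> 'e set"
    and X :: "'m set"
    and f g F :: "'m \<Rightarrow> real"
    and L \<zeta> \<omega>1 \<omega>2 :: real
    and x p :: "nat \<Rightarrow> 'm" and d :: "nat \<Rightarrow> 'e" and lam :: "nat \<Rightarrow> real"
  assumes "riemannian_manifold A \<rho>"
    and "mfd_retraction A R"
    and "inversion_domain R V"
    and "compact X"
    and "R_convex_set R V X"
    and "Rinv_regular_on A R V X"
    and "mfd_C1 A f"
    and "closed_fun g" and "R_convex_fun R V g" and "lower_semicontinuous g"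
    and "F = (\<lambda>y. f y + g y)"
    and "L_smooth A \<rho> R V L f"
    and "0 < \<zeta>" and "\<zeta> < 1"
    and "0 < \<omega>1" and "\<omega>1 < \<omega>2" and "\<omega>2 < 1"
    and "\<forall>s :: nat \<Rightarrow> real. (\<forall>n. s n \<in> F ` {y. F y \<le> F (x 0)}) \<and> decseq s \<longrightarrow> bdd_below (range s)"
    and "gcg_armijo_run A \<rho> R V X f g \<zeta> \<omega>1 \<omega>2 x p d lam"
    and "\<forall>k. gcg_theta A \<rho> R V X f g (x k) < 0"
  shows "\<exists>(J::nat) (C::real). C > 0 \<and>
    (\<forall>\<epsilon>>0. \<exists>k. real k \<le> real J + C / \<epsilon>\<^sup>2 \<and> \<bar>gcg_theta A \<rho> R V X f g (x k)\<bar> \<le> \<epsilon>)"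
proof -
  have at: "smooth_atlas A" and met: "riemannian_metric A \<rho>"
    using assms(1) by (auto simp: riemannian_manifold_def)
  have R: "smooth_from_TM A R" "\<And>y. R y 0 = y" using assms(2) by (auto simp: mfd_retraction_def)
  have def: "Rinv_defined R V y u" if "y \<in> X" "u \<in> X" for y u
    using \<open>Rinv_regular_on A R V X\<close> that by (auto simp: Rinv_regular_on_def)
  have L: "L > 0" using \<open>L_smooth A \<rho> R V L f\<close> by (simp add: L_smooth_def)
  obtain B where B: "B > 0"
    "\<And>y u. y \<in> X \<Longrightarrow> u \<in> X \<Longrightarrow> (rnorm \<rho> y (Rinv R V y u))\<^sup>2 \<le> B"
    using bounded_rnorm_Rinv[OF assms(1) \<open>compact X\<close> \<open>Rinv_regular_on A R V X\<close>] by blast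
  define \<theta> where "\<theta> = (\<lambda>k. gcg_theta A \<rho> R V X f g (x k))"
  \<comment> \<open>The threshold below which the quadratic term
    \<open>L * B * t\<^sup>2 / 2\<close> is at most
    \<open>t * (1 - \<zeta>) * \<bar>\<theta> k\<bar>\<close>.\<close>
  define \<delta> where "\<delta> = (\<lambda>k. 2 * (1 - \<zeta>) / (L * B) * \<bar>\<theta> k\<bar>)"
  have neg: "\<theta> k < 0" for k using assms(20) by (simp add: \<theta>_def)
  have x0: "x 0 \<in> X"
    and run: "\<And>k. is_arg_min (gcg_obj A \<rho> R V f g (x k)) (\<lambda>u. u \<in> X) (p k)"
      "\<And>k. d k = Rinv R V (x k) (p k)"
      "\<And>k. armijo_step R F \<zeta> \<omega>1 \<omega>2 (x k) (d k) (\<theta> k) (lam k)"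
      "\<And>k. x (Suc k) = R (x k) (lam k *\<^sub>R d k)"
    using assms(19) unfolding gcg_armijo_run_def \<theta>_def \<open>F = _\<close> by blast+
  have p: "p k \<in> X" for k using run(1)[of k] by (simp add: is_arg_min_def)
  \<comment> \<open>The infimum over \<open>X\<close> is attained at \<open>p k\<close>.\<close>
  have \<theta>_eq: "\<theta> k = \<rho> (x k) (rgrad A \<rho> f (x k)) (d k) + g (p k) - g (x k)" for k
  proof -
    have "Inf (gcg_obj A \<rho> R V f g (x k) ` X) = gcg_obj A \<rho> R V f g (x k) (p k)"
      using run(1)[of k] by (intro cInf_eq_minimum) (auto simp: is_arg_min_linorder)
    then show ?thesis by (simp add: \<theta>_def gcg_theta_def gcg_obj_def run(2))
  qed
  \<comment> \<open>Conditional on \<open>x k \<in> X\<close>: invariance of \<open>X\<close> comes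
    later and itself uses the step bounds derived from this.\<close>
  have acc: "F (R (x k) (t *\<^sub>R d k)) \<le> F (x k) + \<zeta> * t * \<theta> k"
    if xk: "x k \<in> X" and t: "0 < t" "t \<le> 1" "t \<le> \<delta> k" for k t
  proof -
    have pd: "Rinv_defined R V (x k) (p k)" using def xk p by blast
    have t01: "t \<in> {0..1}" using t by simp
    let ?y = "R (x k) (t *\<^sub>R d k)"
    have y: "?y \<in> X"
      using \<open>R_convex_set R V X\<close> xk p pd t01 by (auto simp: R_convex_set_def run(2))
    \<comment> \<open>L-smoothness speaks of the inverse at the trial point; along the segment it
      returns the scaled direction.\<close>
    have inv: "Rinv R V (x k) ?y = t *\<^sub>R d k"
      unfolding run(2)
      by (rule Rinv_segment[OF at R assms(3) \<open>R_convex_set R V X\<close> \<open>Rinv_regular_on A R V X\<close> xk p t01])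
    have bil: "bilinear (\<rho> (x k))" using met by (simp add: riemannian_metric_def)
    have "(rnorm \<rho> (x k) (t *\<^sub>R d k))\<^sup>2 = t\<^sup>2 * (rnorm \<rho> (x k) (d k))\<^sup>2"
      by (simp add: rnorm_power2[OF met] bilinear_lmul[OF bil] bilinear_rmul[OF bil]
          power2_eq_square[of t])
    also have "\<dots> \<le> t\<^sup>2 * B" using B(2)[OF xk p] by (simp add: run(2) mult_left_mono)
    finally have "L / 2 * (rnorm \<rho> (x k) (t *\<^sub>R d k))\<^sup>2 \<le> L / 2 * (t\<^sup>2 * B)"
      using L by simp
    also have "\<dots> = t * (L * B / 2 * t)" by (simp add: power2_eq_square)
    also have "\<dots> \<le> t * ((1 - \<zeta>) * \<bar>\<theta> k\<bar>)"
      using t L B(1) by (intro mult_left_mono) (auto simp: \<delta>_def field_simps)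
    finally have quad: "L / 2 * (rnorm \<rho> (x k) (t *\<^sub>R d k))\<^sup>2 \<le> - (t * ((1 - \<zeta>) * \<theta> k))"
      using neg[of k] by simp
    have "f ?y \<le> f (x k) + \<rho> (x k) (rgrad A \<rho> f (x k)) (t *\<^sub>R d k)
        + L / 2 * (rnorm \<rho> (x k) (t *\<^sub>R d k))\<^sup>2"
      using \<open>L_smooth A \<rho> R V L f\<close> def[OF xk y] inv by (metis L_smooth_def)
    moreover have "\<rho> (x k) (rgrad A \<rho> f (x k)) (t *\<^sub>R d k) = t * \<rho> (x k) (rgrad A \<rho> f (x k)) (d k)"
      by (simp add: bilinear_rmul[OF bil])
    moreover have "g ?y \<le> (1 - t) * g (x k) + t * g (p k)"
      using \<open>R_convex_fun R V g\<close> pd t01 unfolding R_convex_fun_def run(2) by blast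
    \<comment> \<open>The linear part of \<open>f\<close> and convexity of \<open>g\<close> add up
      to \<open>t * \<theta> k\<close>, and \<open>quad\<close> gives back all but the fraction
      \<zeta>.\<close>
    ultimately show ?thesis
      using quad unfolding \<theta>_eq \<open>F = _\<close> by (simp add: algebra_simps)
  qed
  have step: "0 < lam k" "lam k \<le> 1" "min 1 (\<omega>1 * \<delta> k) \<le> lam k"
      "F (R (x k) (lam k *\<^sub>R d k)) \<le> F (x k) + \<zeta> * lam k * \<theta> k" if "x k \<in> X" for k
    using armijo_step_bounds[OF run(3) \<open>0 < \<omega>1\<close> \<open>\<omega>2 < 1\<close> acc[OF that]] by blast+
  \<comment> \<open>Step sizes lie in the unit interval, so R-convexity keeps the iterates in
    \<open>X\<close>.\<close>
  have xX: "x k \<in> X" for k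
  proof (induction k)
    case (Suc k)
    then have "lam k \<in> {0..1}" using step(1,2) by (simp add: less_imp_le)
    then show ?case
      using \<open>R_convex_set R V X\<close> Suc p def[OF Suc p] by (auto simp: R_convex_set_def run(2,4))
  qed (rule x0)
  \<comment> \<open>Chosen so that
    \<open>\<omega>1 * \<delta> k = b * \<bar>\<theta> k\<bar>\<close>.\<close>
  define b where "b = \<omega>1 * (2 * (1 - \<zeta>) / (L * B))"
  have b: "b > 0" using assms L B by (simp add: b_def)
  have dec: "F (x (Suc k)) \<le> F (x k) - \<zeta> * min 1 (b * \<bar>\<theta> k\<bar>) * \<bar>\<theta> k\<bar>" for k
  proof -
    have "min 1 (b * \<bar>\<theta> k\<bar>) \<le> lam k"
      using step(3)[OF xX, of k] by (simp add: b_def \<delta>_def mult.assoc)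
    then have "\<zeta> * min 1 (b * \<bar>\<theta> k\<bar>) * \<bar>\<theta> k\<bar> \<le> \<zeta> * lam k * \<bar>\<theta> k\<bar>"
      using \<open>0 < \<zeta>\<close> by (intro mult_right_mono mult_left_mono) auto
    then show ?thesis using step(4)[OF xX, of k] neg[of k] by (simp add: run(4))
  qed
  have "F (x (Suc k)) \<le> F (x k)" for k
  proof -
    have "0 \<le> \<zeta> * min 1 (b * \<bar>\<theta> k\<bar>) * \<bar>\<theta> k\<bar>" using \<open>0 < \<zeta>\<close> b by simp
    then show ?thesis using dec[of k] by linarith
  qed
  then have dseq: "decseq (\<lambda>k. F (x k))" by (simp add: decseq_Suc_iff)
  \<comment> \<open>Monotonicity places all iterates in the initial sublevel set, so the boundedness
    hypothesis applies to their values.\<close>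
  then have "F (x k) \<in> F ` {y. F y \<le> F (x 0)}" for k by (auto dest: decseqD[of _ 0 k])
  with dseq have "bdd_below (range (\<lambda>k. F (x k)))"
    by (intro assms(18)[rule_format, of "\<lambda>k. F (x k)"] conjI allI)
  from sufficient_decrease_complexity[where a = "\<lambda>k. F (x k)" and \<theta> = \<theta>, OF \<open>0 < \<zeta>\<close> b dec this]
  show ?thesis by (simp add: \<theta>_def)
qed

end
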